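(* Let $\mathbb{K}$ be an infinite field, $\ell\geq 3$, and let $\mathcal{H}$ be a connected $\ell$-uniform hypergraph. Then $\mathfrak{F}(\mathfrak{F}(\mathcal{H}))=\mathfrak{F}(\mathcal{H})$; that is, the $U$-fusion relation on the frame $\mathfrak{F}(\mathcal{H})$ is equality, so taking the frame of $\mathfrak{F}(\mathcal{H})$ returns $\mathfrak{F}(\mathcal{H})$ (identifying each singleton class with its element).
   Context: Notation: $[\ell]=\{1,\dots,\ell\}$, $\mathrm{Sym}(\ell)$ is the symmetric group on $[\ell]$; for $f\in Y^{[\ell]}$ and $\sigma\in\mathrm{Sym}(\ell)$, $f^{\sigma}(a)=f(a^{\sigma})$. An $\ell$-uniform hypergraph is a pair $\mathcal{H}=(V,E)$ of finite sets where $E$ is a set of orbits of $V^{\ell}$ (functions $[\ell]\to V$) under this action; an edge $e$ is regarded via a representative as an element of $V^{\ell}$, with $e^{\sigma}$ the other elements of its orbit. $\mathcal{H}$ is connected if any two vertices $x,y$ are joined by a walk $x=x_1,e_1,\dots,e_{m-1},x_m=y$ with, for each $i$, $e_i(a_i)=x_i$ and $e_i(b_i)=x_{i+1}$ for some $a_i,b_i\in[\ell]$. $U:\mathbb{K}^{\ell}\to\mathbb{K}$ is $U(\lambda)=\lambda(1)+\cdots+\lambda(\ell)$. A $U$-signal of $\mathcal{H}$ is a function $\delta:[\ell]\to\mathbb{K}^V$, $a\mapsto\delta_a$, such that for all $e\in E$ and $\sigma\in\mathrm{Sym}(\ell)$, $\sum_{a\in[\ell]}\delta_a(e^{\sigma}(a))=0$;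 $\mathrm{Der}(\mathcal{H},U)$ is the set of $U$-signals. The $U$-fusion relation on $V$ is: $x\equiv_U y$ iff $\delta_a(x)=\delta_a(y)$ for all $\delta\in\mathrm{Der}(\mathcal{H},U)$ and $a\in[\ell]$. Quotient: for an equivalence relation on $V$ with classes $\bar{x}$, the quotient hypergraph is $(\bar{V},\bar{E})$ with $\bar{V}=\{\bar{x}\mid x\in V\}$ and $\bar{E}=\{\bar{e}\mid e\in E\}$, where $\bar{e}(a)=\overline{e(a)}$. The frame $\mathfrak{F}(\mathcal{H})$ is the quotient of $\mathcal{H}$ by $U$-fusion (it is again a connected $\ell$-uniform hypergraph). *)

theory Defs
  imports Main "HOL-Library.FuncSet" "HOL-Combinatorics.Permutations"
begin

text \<open>
  A function \<open>[\<ell>] \<rightarrow> V\<close> is an element of \<^term>\<open>{1..l::nat} \<rightarrow>\<^sub>E V\<close>.  Since a permutation of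
  \<^term>\<open>{1..l::nat}\<close> in the sense of \<^const>\<open>permutes\<close> fixes all other numbers, the action
  \<open>f\<^sup>\<sigma>(a) = f(a\<^sup>\<sigma>)\<close> is plain composition \<^term>\<open>f \<circ> \<sigma>\<close> and preserves extensionality.
\<close>

definition sym_orbit :: "nat \<Rightarrow> (nat \<Rightarrow> 'a) \<Rightarrow> (nat \<Rightarrow> 'a) set" where
  "sym_orbit l f = {f \<circ> \<sigma> |\<sigma>. \<sigma> permutes {1..l}}"

text \<open>Edges are the orbits themselves; the elements of an edge are its representatives.\<close>

type_synonym 'a hypergraph = "'a set \<times> (nat \<Rightarrow> 'a) set set"

abbreviation verts :: "'a hypergraph \<Rightarrow> 'a set" where
  "verts H \<equiv> fst H"

abbreviation edges :: "'a hypergraph \<Rightarrow> (nat \<Rightarrow> 'a) set set" where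
  "edges H \<equiv> snd H"

definition uniform_hypergraph :: "nat \<Rightarrow> 'a hypergraph \<Rightarrow> bool" where
  "uniform_hypergraph l H \<longleftrightarrow>
     finite (verts H) \<and> finite (edges H) \<and>
     edges H \<subseteq> sym_orbit l ` ({1..l} \<rightarrow>\<^sub>E verts H)"

text \<open>The walk \<open>x\<^sub>1, e\<^sub>1, \<dots>, e\<^sub>m\<^sub>-\<^sub>1, x\<^sub>m\<close>; the walk condition on an edge does not depend on
  its representative \<open>g\<close>.\<close>

definition walk ::
    "nat \<Rightarrow> 'a hypergraph \<Rightarrow> nat \<Rightarrow> (nat \<Rightarrow> 'a) \<Rightarrow> (nat \<Rightarrow> (nat \<Rightarrow> 'a) set) \<Rightarrow> bool" where
  "walk l H m x e \<longleftrightarrow>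
     1 \<le> m \<and> (\<forall>i\<in>{1..m}. x i \<in> verts H) \<and>
     (\<forall>i\<in>{1..<m}. e i \<in> edges H \<and>
        (\<exists>g\<in>e i. \<exists>a\<in>{1..l}. \<exists>b\<in>{1..l}. g a = x i \<and> g b = x (Suc i)))"

definition connected_hypergraph :: "nat \<Rightarrow> 'a hypergraph \<Rightarrow> bool" where
  "connected_hypergraph l H \<longleftrightarrow>
     (\<forall>x\<in>verts H. \<forall>y\<in>verts H. \<exists>m xs es. walk l H m xs es \<and> xs 1 = x \<and> xs m = y)"

definition U :: "nat \<Rightarrow> (nat \<Rightarrow> 'k::field) \<Rightarrow> 'k" where
  "U l v = (\<Sum>a\<in>{1..l}. v a)"

definition Der_U :: "nat \<Rightarrow> 'a hypergraph \<Rightarrow> (nat \<Rightarrow> 'a \<Rightarrow> 'k::field) set" where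
  "Der_U l H =
     {\<delta> \<in> {1..l} \<rightarrow>\<^sub>E (verts H \<rightarrow>\<^sub>E UNIV).
        \<forall>e\<in>edges H. \<forall>g\<in>e. \<forall>\<sigma>. \<sigma> permutes {1..l} \<longrightarrow>
          U l (\<lambda>a. \<delta> a ((g \<circ> \<sigma>) a)) = 0}"

text \<open>The field does not occur in the type of the result, hence the type argument.\<close>

definition U_fusion :: "'k::field itself \<Rightarrow> nat \<Rightarrow> 'a hypergraph \<Rightarrow> ('a \<times> 'a) set" where
  "U_fusion K l H =
     {(x, y) \<in> verts H \<times> verts H.
        \<forall>\<delta> \<in> (Der_U l H :: (nat \<Rightarrow> 'a \<Rightarrow> 'k) set). \<forall>a\<in>{1..l}. \<delta> a x = \<delta> a y}"

definition image_edge :: "nat \<Rightarrow> ('a \<Rightarrow> 'b) \<Rightarrow> (nat \<Rightarrow> 'a) set \<Rightarrow> (nat \<Rightarrow> 'b) set" where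
  "image_edge l \<phi> e = (\<lambda>g. \<lambda>a\<in>{1..l}. \<phi> (g a)) ` e"

definition image_hypergraph :: "nat \<Rightarrow> ('a \<Rightarrow> 'b) \<Rightarrow> 'a hypergraph \<Rightarrow> 'b hypergraph" where
  "image_hypergraph l \<phi> H = (\<phi> ` verts H, image_edge l \<phi> ` edges H)"

definition quotient_hypergraph ::
    "nat \<Rightarrow> ('a \<times> 'a) set \<Rightarrow> 'a hypergraph \<Rightarrow> 'a set hypergraph" where
  "quotient_hypergraph l R H = image_hypergraph l (\<lambda>x. R `` {x}) H"

definition hframe :: "'k::field itself \<Rightarrow> nat \<Rightarrow> 'a hypergraph \<Rightarrow> 'a set hypergraph" where
  "hframe K l H = quotient_hypergraph l (U_fusion K l H) H"

end

theory Submission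
  imports Defs
begin

text \<open>
  Every signal \<open>\<delta>\<close> of \<open>H\<close> is constant on fusion classes, hence descends to a signal of the frame.
  Distinct fusion classes are separated by some \<open>\<delta>\<close>, and so by the descended signal.
\<close>

lemma edge_in_verts:
  assumes "uniform_hypergraph l H" "e \<in> edges H" "g \<in> e" "a \<in> {1..l}"
  shows "g a \<in> verts H"
proof -
  obtain f \<sigma> where f: "f \<in> {1..l} \<rightarrow>\<^sub>E verts H" and \<sigma>: "\<sigma> permutes {1..l}" and g: "g = f \<circ> \<sigma>"
    using assms(1-3) unfolding uniform_hypergraph_def sym_orbit_def by blast
  have "\<sigma> a \<in> {1..l}"
    using permutes_in_image[OF \<sigma>] assms(4) by blast
  then show ?thesis
    using f g by auto
qed

text \<open>Every representative of an image edge is the pointwise image of a representative of an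
  edge of \<open>H\<close>, so the property is inherited from \<open>H\<close>. The frame is such an
  image.\<close>

lemma edge_in_verts_image:
  assumes "uniform_hypergraph l H" "e \<in> edges (image_hypergraph l \<phi> H)" "g \<in> e" "a \<in> {1..l}"
  shows "g a \<in> verts (image_hypergraph l \<phi> H)"
  using assms(2-4) edge_in_verts[OF assms(1)]
  unfolding image_hypergraph_def image_edge_def by fastforce

text \<open>Serves to compare two quotient maps that agree on vertices but may differ elsewhere: the
  image only ever evaluates them at vertices.\<close>

lemma image_hypergraph_cong:
  assumes "\<And>x. x \<in> verts H \<Longrightarrow> \<phi> x = \<psi> x"
    and "\<And>e g a. e \<in> edges H \<Longrightarrow> g \<in> e \<Longrightarrow> a \<in> {1..l} \<Longrightarrow> g a \<in> verts H"
  shows "image_hypergraph l \<phi> H = image_hypergraph l \<psi> H"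
proof -
  have "image_edge l \<phi> e = image_edge l \<psi> e" if "e \<in> edges H" for e
    unfolding image_edge_def
    by (intro image_cong restrict_ext refl assms(1) assms(2)[OF that])
  then show ?thesis
    using assms(1) unfolding image_hypergraph_def by (simp cong: image_cong)
qed

lemma equiv_U_fusion: "equiv (verts H) (U_fusion K l H)"
  unfolding U_fusion_def by (intro equivI refl_onI symI transI) auto

text \<open>A class is evaluated at an arbitrarily chosen member. The two restrictions provide the
  extensionality that \<open>Der_U\<close> demands.\<close>

definition descend ::
    "nat \<Rightarrow> 'a set hypergraph \<Rightarrow> (nat \<Rightarrow> 'a \<Rightarrow> 'k) \<Rightarrow> nat \<Rightarrow> 'a set \<Rightarrow> 'k" where
  "descend l F \<delta> = (\<lambda>a\<in>{1..l}. \<lambda>X\<in>verts F. \<delta> a (SOME x. x \<in> X))"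

text \<open>The choice of member is harmless, because fused vertices have equal values under every
  signal.\<close>

lemma descend_class:
  fixes \<delta> :: "nat \<Rightarrow> 'a \<Rightarrow> 'k::field" and K :: "'k itself"
  assumes "\<delta> \<in> Der_U l H" "x \<in> verts H" "a \<in> {1..l}"
  shows "descend l (hframe K l H) \<delta> a (U_fusion K l H `` {x}) = \<delta> a x"
proof -
  let ?X = "U_fusion K l H `` {x}"
  have "?X \<in> verts (hframe K l H)"
    using assms(2) unfolding hframe_def quotient_hypergraph_def image_hypergraph_def by simp
  moreover have "x \<in> ?X"
    using equiv_class_self[OF equiv_U_fusion assms(2)] .
  \<comment> \<open>The class contains \<open>x\<close>, so the choice really picks a member of
    it.\<close>
  then have "(SOME y. y \<in> ?X) \<in> ?X"
    by (rule someI)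
  then have "\<delta> a (SOME y. y \<in> ?X) = \<delta> a x"
    using assms(1,3) unfolding U_fusion_def by auto
  ultimately show ?thesis
    using assms(3) by (simp add: descend_def)
qed

text \<open>Each representative of a frame edge lifts to one of an edge of \<open>H\<close>, and the
  two signal sums agree term by term.\<close>

lemma descend_in_Der_U:
  fixes \<delta> :: "nat \<Rightarrow> 'a \<Rightarrow> 'k::field" and K :: "'k itself"
  assumes "uniform_hypergraph l H" "\<delta> \<in> Der_U l H"
  shows "descend l (hframe K l H) \<delta> \<in> Der_U l (hframe K l H)"
  unfolding Der_U_def
proof (intro CollectI conjI ballI allI impI)
  show "descend l (hframe K l H) \<delta> \<in> {1..l} \<rightarrow>\<^sub>E (verts (hframe K l H) \<rightarrow>\<^sub>E UNIV)"
    unfolding descend_def by simp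
next
  fix e g \<sigma>
  assume "e \<in> edges (hframe K l H)" "g \<in> e" and \<sigma>: "\<sigma> permutes {1..l}"
  then obtain e' g' where e': "e' \<in> edges H" "g' \<in> e'"
    and g: "g = (\<lambda>a\<in>{1..l}. U_fusion K l H `` {g' a})"
    unfolding hframe_def quotient_hypergraph_def image_hypergraph_def image_edge_def by auto
  have "descend l (hframe K l H) \<delta> a ((g \<circ> \<sigma>) a) = \<delta> a ((g' \<circ> \<sigma>) a)" if a: "a \<in> {1..l}" for a
  proof -
    \<comment> \<open>\<open>g\<close> is a class of the frame only inside the index range, so the
      permuted index must be known to stay there.\<close>
    have \<sigma>a: "\<sigma> a \<in> {1..l}"
      using permutes_in_image[OF \<sigma>] a by blast
    then show ?thesis
      using descend_class[OF assms(2) edge_in_verts[OF assms(1) e' \<sigma>a] a, of K] by (simp add: g)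
  qed
  then have "U l (\<lambda>a. descend l (hframe K l H) \<delta> a ((g \<circ> \<sigma>) a)) = U l (\<lambda>a. \<delta> a ((g' \<circ> \<sigma>) a))"
    unfolding U_def by (intro sum.cong refl)
  also have "\<dots> = 0"
    using assms(2) e' \<sigma> unfolding Der_U_def by blast
  finally show "U l (\<lambda>a. descend l (hframe K l H) \<delta> a ((g \<circ> \<sigma>) a)) = 0" .
qed

lemma U_fusion_hframe:
  fixes K :: "'k::field itself"
  assumes "uniform_hypergraph l H"
  shows "U_fusion K l (hframe K l H) = Id_on (verts (hframe K l H))"
proof (intro equalityI subrelI)
  fix X Y
  assume XY: "(X, Y) \<in> U_fusion K l (hframe K l H)"
  then obtain x y where x: "x \<in> verts H" "X = U_fusion K l H `` {x}"
    and y: "y \<in> verts H" "Y = U_fusion K l H `` {y}"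
    unfolding U_fusion_def[of K l "hframe K l H"]
    by (auto simp: hframe_def quotient_hypergraph_def image_hypergraph_def)
  have "\<delta> a x = \<delta> a y" if "\<delta> \<in> Der_U l H" "a \<in> {1..l}" for \<delta> :: "nat \<Rightarrow> 'a \<Rightarrow> 'k" and a
  proof -
    \<comment> \<open>Fusion of \<open>X\<close> and \<open>Y\<close> in the frame is tested on one
      particular signal, the descent of \<delta>.\<close>
    have "descend l (hframe K l H) \<delta> a X = descend l (hframe K l H) \<delta> a Y"
      using XY descend_in_Der_U[OF assms that(1), of K] that(2)
      unfolding U_fusion_def[of K l "hframe K l H"] by blast
    then show ?thesis
      using descend_class[OF that(1) _ that(2), of _ K] x y by simp
  qed
  then have "(x, y) \<in> U_fusion K l H"
    using x y unfolding U_fusion_def by blast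
  then have "X = Y"
    using equiv_class_eq[OF equiv_U_fusion] x y by simp
  then show "(X, Y) \<in> Id_on (verts (hframe K l H))"
    using XY unfolding U_fusion_def[of K l "hframe K l H"] by auto
next
  fix X Y
  assume "(X, Y) \<in> Id_on (verts (hframe K l H))"
  then show "(X, Y) \<in> U_fusion K l (hframe K l H)"
    unfolding U_fusion_def[of K l "hframe K l H"] by auto
qed

theorem theorem6p4:
  fixes l :: nat and H :: "'a hypergraph"
  assumes "infinite (UNIV :: 'k::field set)"
    and "l \<ge> 3"
    and "uniform_hypergraph l H"
    and "connected_hypergraph l H"
  shows "U_fusion TYPE('k) l (hframe TYPE('k) l H) = Id_on (verts (hframe TYPE('k) l H))
       \<and> hframe TYPE('k) l (hframe TYPE('k) l H)
           = image_hypergraph l (\<lambda>X. {X}) (hframe TYPE('k) l H)"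
proof
  let ?F = "hframe TYPE('k) l H"
  show fus: "U_fusion TYPE('k) l ?F = Id_on (verts ?F)"
    using U_fusion_hframe[OF assms(3)] .
  have "g a \<in> verts ?F" if "e \<in> edges ?F" "g \<in> e" "a \<in> {1..l}" for e g a
    using edge_in_verts_image[OF assms(3)] that unfolding hframe_def quotient_hypergraph_def .
  \<comment> \<open>The two maps agree only on vertices: elsewhere the class under
    \<open>Id_on\<close> is empty rather than a singleton.\<close>
  then have "image_hypergraph l (\<lambda>X. Id_on (verts ?F) `` {X}) ?F = image_hypergraph l (\<lambda>X. {X}) ?F"
    by (intro image_hypergraph_cong) auto
  then show "hframe TYPE('k) l ?F = image_hypergraph l (\<lambda>X. {X}) ?F"
    unfolding hframe_def[of "TYPE('k)" l ?F] quotient_hypergraph_def fus .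
qed

end
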